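(* Let $f,\bar f:\mathbb V^{n_x}\to\mathbb V^{n_x}$ be the full-system uncertainty-propagation operator and the truth full-system uncertainty-propagation operator of a network, let $h:\mathbb V^{n_x}\to\mathbb V^{n_x}$ be a fixed-point operator for $f$ and $\bar h:\mathbb V^{n_x}\to\mathbb V^{n_x}$ a truth fixed-point operator for $\bar f$. Let $x_\star$ be a solution of $x_\star=f(x_\star)$ (so that $x_\star=h(x_\star)$) and let $\bar x_\star$ be a solution of $\bar x_\star=\bar f(\bar x_\star)$ (so that $\bar x_\star=\bar h(\bar x_\star)$). Assume that $h$ is a contraction: there is a Lipschitz constant $L_h<1$ with $$\|h(x_1)-h(x_2)\|\le L_h\|x_1-x_2\|\qquad\text{for all }x_1,x_2\in\mathbb V^{n_x}.$$ Then $$\|\bar x_\star-x_\star\|\le\frac{1}{1-L_h}\,\|\bar x_\star-h(\bar x_\star)\|.$$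
   Context: $\mathbb V$ is the real vector space of real-valued random variables on a fixed probability space, equipped with a norm $\|\cdot\|$ (e.g. $\|x\|=(\mathbb E|x|^p)^{1/p}$); it may be treated as an abstract real normed space. For $N\in\mathbb N$, $\mathbb V^N$ also carries a norm, denoted $\|\cdot\|$ as well (e.g. $\|x\|=(\sum_{i}\|x_i\|^q)^{1/q}$). Network: there are $n$ components; component $i$ has $n_{y,i}$ endogenous inputs and $n_{x,i}$ outputs, $n_y=\sum_i n_{y,i}$, $n_x=\sum_i n_{x,i}$. Exogenous inputs are fixed throughout and suppressed from the notation. Each component has an uncertainty-propagation operator $f_i:\mathbb V^{n_{y,i}}\to\mathbb V^{n_{x,i}}$ and a "truth" uncertainty-propagation operator $\bar f_i:\mathbb V^{n_{y,i}}\to\mathbb V^{n_{x,i}}$ (which $f_i$ approximates). $E_i^x\in\{0,1\}^{n_{x,i}\times n_x}$ and $E_i^y\in\{0,1\}^{n_{y,i}\times n_y}$ are the rows of the identity matrix extracting the block of component $i$. The adjacency matrix $A\in\{0,1\}^{n_y\times n_x}$ expresses the endogenous inputs as outputs, $y=Ax$; its diagonal blocks $E_i^yA(E_i^x)^T$ are zero. The full-system operators are $$f(x)=\sum_{i=1}^n(E_i^x)^Tf_i(E_i^yAx),\qquad \bar f(x)=\sum_{i=1}^n(E_i^x)^T\bar f_i(E_i^yAx).$$ A fixed-point operator for $f$ is any function $h:\mathbb V^{n_x}\to\mathbb V^{n_x}$ such that $x\mapsto x-h(x)$ and $x\mapsto x-f(x)$ have the same roots; a truth fixed-point operator is any function $\bar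 h:\mathbb V^{n_x}\to\mathbb V^{n_x}$ such that $x\mapsto x-\bar h(x)$ and $x\mapsto x-\bar f(x)$ have the same roots. *)

theory Defs
  imports Complex_Main "Jordan_Normal_Form.Matrix"
begin

text \<open>
  The space of random variables is an arbitrary type \<open>'v\<close> of class
  \<^class>\<open>real_normed_vector\<close>, and \<open>V^N\<close> is \<open>carrier_vec N\<close> over that type.
  Scalar multiplication on \<open>'v vec\<close> in the library presupposes a multiplication on \<open>'v\<close>,
  so scalars and matrices over the reals act through \<^const>\<open>scaleR\<close>.
\<close>

definition vec_scaleR :: "real \<Rightarrow> 'v::real_normed_vector vec \<Rightarrow> 'v vec" where
  "vec_scaleR c x = map_vec (\<lambda>a. c *\<^sub>R a) x"

definition mat_act :: "real mat \<Rightarrow> 'v::real_normed_vector vec \<Rightarrow> 'v vec" where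
  "mat_act M x = vec (dim_row M) (\<lambda>i. \<Sum>j<dim_col M. M $$ (i, j) *\<^sub>R x $ j)"

definition is_norm_on_vec :: "nat \<Rightarrow> ('v::real_normed_vector vec \<Rightarrow> real) \<Rightarrow> bool" where
  "is_norm_on_vec N nrm \<longleftrightarrow>
     (\<forall>x\<in>carrier_vec N. 0 \<le> nrm x) \<and>
     (\<forall>x\<in>carrier_vec N. nrm x = 0 \<longleftrightarrow> x = 0\<^sub>v N) \<and>
     (\<forall>c. \<forall>x\<in>carrier_vec N. nrm (vec_scaleR c x) = \<bar>c\<bar> * nrm x) \<and>
     (\<forall>x\<in>carrier_vec N. \<forall>y\<in>carrier_vec N. nrm (x + y) \<le> nrm x + nrm y)"

text \<open>
  Components and coordinates are numbered from 0.  For block sizes \<open>d 0, \<dots>, d (n - 1)\<close>,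
  \<open>block_mat n d i\<close> consists of the rows of the identity matrix that belong to block \<open>i\<close>:
  it is \<open>E\<^sub>i\<^sup>x\<close> for \<open>d = nx\<close> and \<open>E\<^sub>i\<^sup>y\<close> for \<open>d = ny\<close>.
\<close>

definition total_dim :: "nat \<Rightarrow> (nat \<Rightarrow> nat) \<Rightarrow> nat" where
  "total_dim n d = (\<Sum>i<n. d i)"

definition block_mat :: "nat \<Rightarrow> (nat \<Rightarrow> nat) \<Rightarrow> nat \<Rightarrow> real mat" where
  "block_mat n d i = mat (d i) (total_dim n d)
     (\<lambda>(k, l). 1\<^sub>m (total_dim n d) $$ ((\<Sum>j<i. d j) + k, l))"

definition adjacency_matrix ::
    "nat \<Rightarrow> (nat \<Rightarrow> nat) \<Rightarrow> (nat \<Rightarrow> nat) \<Rightarrow> real mat \<Rightarrow> bool" where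
  "adjacency_matrix n ny nx A \<longleftrightarrow>
     A \<in> carrier_mat (total_dim n ny) (total_dim n nx) \<and>
     elements_mat A \<subseteq> {0, 1} \<and>
     (\<forall>i<n. block_mat n ny i * A * transpose_mat (block_mat n nx i) = 0\<^sub>m (ny i) (nx i))"

definition component_operators ::
    "nat \<Rightarrow> (nat \<Rightarrow> nat) \<Rightarrow> (nat \<Rightarrow> nat) \<Rightarrow>
      (nat \<Rightarrow> 'v::real_normed_vector vec \<Rightarrow> 'v vec) \<Rightarrow> bool" where
  "component_operators n ny nx F \<longleftrightarrow> (\<forall>i<n. F i \<in> carrier_vec (ny i) \<rightarrow> carrier_vec (nx i))"

definition full_system ::
    "nat \<Rightarrow> (nat \<Rightarrow> nat) \<Rightarrow> (nat \<Rightarrow> nat) \<Rightarrow> real mat \<Rightarrow>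
      (nat \<Rightarrow> 'v::real_normed_vector vec \<Rightarrow> 'v vec) \<Rightarrow> 'v vec \<Rightarrow> 'v vec" where
  "full_system n ny nx A F x =
     finsum_vec TYPE('v) (total_dim n nx)
       (\<lambda>i. mat_act (transpose_mat (block_mat n nx i))
              (F i (mat_act (block_mat n ny i) (mat_act A x)))) {..<n}"

definition vec_roots ::
    "nat \<Rightarrow> ('v::real_normed_vector vec \<Rightarrow> 'v vec) \<Rightarrow> 'v vec set" where
  "vec_roots N g = {x \<in> carrier_vec N. g x = 0\<^sub>v N}"

definition fixed_point_operator ::
    "nat \<Rightarrow> ('v::real_normed_vector vec \<Rightarrow> 'v vec) \<Rightarrow> ('v vec \<Rightarrow> 'v vec) \<Rightarrow> bool" where
  "fixed_point_operator N f h \<longleftrightarrow>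
     h \<in> carrier_vec N \<rightarrow> carrier_vec N \<and>
     vec_roots N (\<lambda>x. x - h x) = vec_roots N (\<lambda>x. x - f x)"

end

theory Submission
  imports Defs
begin

text \<open>
  The solution \<open>x\<close> is a fixed point of \<open>f\<close>, hence of
  its fixed-point operator \<open>h\<close>, because the two residuals have the same roots.  Any other vector \<open>z\<close>
  is then compared with \<open>x\<close> by one step of \<open>h\<close>: the distance from \<open>z\<close> to \<open>x = h x\<close> is at most the
  residual \<open>\<parallel>z - h z\<parallel>\<close> plus \<open>\<parallel>h z - h x\<parallel>\<close>, and the contraction bounds the second term by
  \<open>L \<parallel>z - x\<parallel>\<close>, which is absorbed into the left-hand side since \<open>L < 1\<close>.  This is the a posteriori
  error estimate of the Banach fixed-point theorem, taken at the point \<open>z\<close> that solves the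
  truth system.
\<close>

lemma vec_minus_eq_zero_iff:
  fixes x y :: "'v::ab_group_add vec"
  assumes "x \<in> carrier_vec N" "y \<in> carrier_vec N"
  shows "x - y = 0\<^sub>v N \<longleftrightarrow> x = y"
  using assms by (auto simp: vec_eq_iff)

lemma fixed_point_operator_fixed_iff:
  fixes f h :: "'v::real_normed_vector vec \<Rightarrow> 'v vec"
  assumes h: "fixed_point_operator N f h"
    and x: "x \<in> carrier_vec N" and fx: "f x \<in> carrier_vec N"
  shows "h x = x \<longleftrightarrow> f x = x"
proof -
  have hx: "h x \<in> carrier_vec N"
    using h x by (auto simp: fixed_point_operator_def)
  have "x \<in> vec_roots N (\<lambda>x. x - h x) \<longleftrightarrow> x \<in> vec_roots N (\<lambda>x. x - f x)"
    using h by (simp add: fixed_point_operator_def)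
  then show ?thesis
    using x vec_minus_eq_zero_iff[OF x hx] vec_minus_eq_zero_iff[OF x fx]
    by (auto simp: vec_roots_def)
qed

text \<open>
  The triangle inequality, applied to a detour through \<open>h z\<close>, turns the distance to the fixed point
  into the residual at \<open>z\<close> plus a multiple of itself that is smaller than the whole.
\<close>

lemma contraction_residual_bound:
  fixes h :: "'v::real_normed_vector vec \<Rightarrow> 'v vec"
  assumes norm: "is_norm_on_vec N nrm"
    and x: "x \<in> carrier_vec N" and fixed: "h x = x"
    and z: "z \<in> carrier_vec N" and hz: "h z \<in> carrier_vec N"
    and L: "L < 1" and contr: "nrm (h z - h x) \<le> L * nrm (z - x)"
  shows "nrm (z - x) \<le> 1 / (1 - L) * nrm (z - h z)"
proof -
  have "z - x = (z - h z) + (h z - h x)"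
    using x z hz fixed by (auto simp: vec_eq_iff)
  also have "nrm \<dots> \<le> nrm (z - h z) + nrm (h z - h x)"
    using norm x z hz fixed by (simp add: is_norm_on_vec_def)
  also have "\<dots> \<le> nrm (z - h z) + L * nrm (z - x)"
    using contr by simp
  finally have "(1 - L) * nrm (z - x) \<le> nrm (z - h z)"
    by (simp add: algebra_simps)
  then show ?thesis
    using L by (simp add: field_simps)
qed

theorem proposition5p2:
  fixes n :: nat and ny nx :: "nat \<Rightarrow> nat"
    and A :: "real mat"
    and fc fc_bar :: "nat \<Rightarrow> 'v::real_normed_vector vec \<Rightarrow> 'v vec"
    and f f_bar h h_bar :: "'v vec \<Rightarrow> 'v vec"
    and nrm :: "'v vec \<Rightarrow> real"
    and x_star x_bar_star :: "'v vec"
    and L_h :: real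
  assumes norm: "is_norm_on_vec (total_dim n nx) nrm"
    and adjacency: "adjacency_matrix n ny nx A"
    and components: "component_operators n ny nx fc"
    and truth_components: "component_operators n ny nx fc_bar"
    and f: "f = full_system n ny nx A fc"
    and f_bar: "f_bar = full_system n ny nx A fc_bar"
    and h: "fixed_point_operator (total_dim n nx) f h"
    and h_bar: "fixed_point_operator (total_dim n nx) f_bar h_bar"
    and x_star: "x_star \<in> carrier_vec (total_dim n nx)" "x_star = f x_star"
    and x_bar_star: "x_bar_star \<in> carrier_vec (total_dim n nx)" "x_bar_star = f_bar x_bar_star"
    and contraction: "L_h < 1"
      "\<forall>x\<^sub>1 \<in> carrier_vec (total_dim n nx). \<forall>x\<^sub>2 \<in> carrier_vec (total_dim n nx).
         nrm (h x\<^sub>1 - h x\<^sub>2) \<le> L_h * nrm (x\<^sub>1 - x\<^sub>2)"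
  shows "nrm (x_bar_star - x_star) \<le> 1 / (1 - L_h) * nrm (x_bar_star - h x_bar_star)"
proof -
  have "f x_star \<in> carrier_vec (total_dim n nx)"
    using x_star by simp
  then have "h x_star = x_star"
    using fixed_point_operator_fixed_iff[OF h x_star(1)] x_star(2) by simp
  moreover have "h x_bar_star \<in> carrier_vec (total_dim n nx)"
    using h x_bar_star(1) by (auto simp: fixed_point_operator_def)
  ultimately show ?thesis
    using contraction_residual_bound[OF norm x_star(1) _ x_bar_star(1)]
      contraction x_star(1) x_bar_star(1) by blast
qed

end
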